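(* The general determinant is multiplicative for composition and for block triangular form: (i) If $B=(b_{i,j})$ and $C=(c_{r,s})$ are two general $n\times n$ matrices (in disjoint sets of independent variables), then, in $\mathbb{Z}[b_{i,j},c_{r,s}]_{1\le i,j,r,s\le n}$, $$\det(B\cdot C)=\det(C)\,\det(B).$$ (ii) If $U$, $V$, $W$ are three general matrices, of sizes $p\times p$, $q\times q$ and $p\times q$ respectively (in disjoint sets of independent variables), then, over the polynomial ring with integer coefficients in all the entries of $U,V,W$, $$\det\begin{pmatrix}U&W\\0&V\end{pmatrix}=\det(U)\,\det(V),\qquad \widetilde{\begin{pmatrix}U&W\\0&V\end{pmatrix}}=\begin{pmatrix}\det(V)\,\widetilde{U}&-\widetilde{U}\cdot W\cdot\widetilde{V}\\0&\det(U)\,\widetilde{V}\end{pmatrix}.$$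
   Context: Let $n\geq 1$, $\widetilde{\Lambda}_n=\mathbb{Z}[a_{i,j}]_{1\le i,j\le n}$ be the polynomial ring in $n^2$ variables, a factorial ring with units $\{-1,1\}$, and $\widetilde{K}_n$ its fraction field. The general $n\times n$ matrix is $A=(a_{i,j})\in M_n(\widetilde{\Lambda}_n)$, the matrix whose entries are the independent variables; a general matrix of size $p\times q$ is likewise one whose entries are independent variables. $A$ is invertible in $M_n(\widetilde{K}_n)$. Any $M\in M_n(\widetilde{K}_n)$ whose entries are defined at $A=\mathrm{Id}$ has a unique reduced expression $M=\frac{N}{d}$ with $N\in M_n(\widetilde{\Lambda}_n)$, $d\in\widetilde{\Lambda}_n$, $d(\mathrm{Id})>0$ ($d$ evaluated at $a_{i,j}=\delta_{i,j}$), and $N$ (all its entries) and $d$ without common factor. The general determinant $\det(A)$ and the general comatrix $\widetilde{A}$ are by definition the denominator and the numerator of the reduced expression $A^{-1}=\frac{\widetilde{A}}{\det(A)}$. For a matrix $M$ of size $n$ with entries in a commutative ring, $\det(M)$ and $\widetilde{M}$ are obtained by substituting the entries of $M$ for the variables $a_{i,j}$ in $\det(A)$ and $\widetilde{A}$. *)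

theory Defs
  imports
    "HOL-Library.Poly_Mapping"
    "HOL-Library.Product_Lexorder"
    "HOL-Computational_Algebra.Fraction_Field"
    "Jordan_Normal_Form.Matrix"
begin

text \<open>Matrix indices start at 0, as in the matrix library: the paper's variable
  a(i+1,j+1) is the variable named (i,j).\<close>

type_synonym 'v int_mpoly = "('v \<Rightarrow>\<^sub>0 nat) \<Rightarrow>\<^sub>0 int"

definition Var :: "'v \<Rightarrow> 'v int_mpoly" where
  "Var v = Poly_Mapping.single (Poly_Mapping.single v 1) 1"

definition mpoly_vars :: "'v int_mpoly \<Rightarrow> 'v set" where
  "mpoly_vars f = (\<Union>m\<in>Poly_Mapping.keys f. Poly_Mapping.keys m)"

definition subst_mpoly :: "('v \<Rightarrow> 'a :: comm_ring_1) \<Rightarrow> 'v int_mpoly \<Rightarrow> 'a" where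
  "subst_mpoly x f =
     (\<Sum>m\<in>Poly_Mapping.keys f. of_int (Poly_Mapping.lookup f m) *
        (\<Prod>v\<in>Poly_Mapping.keys m. x v ^ Poly_Mapping.lookup m v))"

definition indices :: "nat \<Rightarrow> nat \<Rightarrow> (nat \<times> nat) set" where
  "indices p q = {..<p} \<times> {..<q}"

text \<open>The matrix of size \<open>p\<close> by \<open>q\<close> whose entries are the variables named by \<open>x\<close>.
  It is a general matrix (the entries are independent variables) if \<open>x\<close> is injective
  on \<open>indices p q\<close>.\<close>

definition general_mat :: "nat \<Rightarrow> nat \<Rightarrow> (nat \<times> nat \<Rightarrow> 'v) \<Rightarrow> 'v int_mpoly mat" where
  "general_mat p q x = mat p q (\<lambda>ij. Var (x ij))"

text \<open>The ring of integer polynomials in the variables (i,j) with i, j < n, as a subring of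
  the polynomials in all variables (i,j). Accordingly its fraction field is seen inside the
  fraction field of the large ring.\<close>

definition Lambda :: "nat \<Rightarrow> (nat \<times> nat) int_mpoly set" where
  "Lambda n = {f. mpoly_vars f \<subseteq> indices n n}"

definition eval_Id :: "(nat \<times> nat) int_mpoly \<Rightarrow> int" where
  "eval_Id = subst_mpoly (\<lambda>(i, j). if i = j then 1 else 0)"

text \<open>\<open>M = N/d\<close> is a reduced expression. Its existence forces the entries of \<open>M\<close> to be
  defined at the identity. Divisibility in \<open>Lambda n\<close> is the same as in the large ring, since
  factors of a nonzero polynomial only involve variables of that polynomial.\<close>

definition reduced_expression ::
  "nat \<Rightarrow> (nat \<times> nat) int_mpoly fract mat \<Rightarrow>
     (nat \<times> nat) int_mpoly mat \<Rightarrow> (nat \<times> nat) int_mpoly \<Rightarrow> bool" where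
  "reduced_expression n M N d \<longleftrightarrow>
     N \<in> carrier_mat n n \<and> elements_mat N \<subseteq> Lambda n \<and> d \<in> Lambda n \<and>
     eval_Id d > 0 \<and>
     M = map_mat (\<lambda>f. Fraction_Field.Fract f d) N \<and>
     (\<forall>g \<in> Lambda n. g dvd d \<and> (\<forall>f \<in> elements_mat N. g dvd f) \<longrightarrow> g dvd 1)"

definition general_inverse :: "nat \<Rightarrow> (nat \<times> nat) int_mpoly fract mat" where
  "general_inverse n =
     inv\<^bsub>ring_mat TYPE((nat \<times> nat) int_mpoly fract) n ()\<^esub>
       (map_mat (\<lambda>f. Fraction_Field.Fract f 1) (general_mat n n (\<lambda>ij. ij)))"

definition general_det :: "nat \<Rightarrow> (nat \<times> nat) int_mpoly" where
  "general_det n = (THE d. \<exists>N. reduced_expression n (general_inverse n) N d)"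

definition general_comatrix :: "nat \<Rightarrow> (nat \<times> nat) int_mpoly mat" where
  "general_comatrix n = (THE N. \<exists>d. reduced_expression n (general_inverse n) N d)"

text \<open>For a square matrix \<open>M\<close> over a commutative ring.\<close>

definition mat_det :: "'a :: comm_ring_1 mat \<Rightarrow> 'a" where
  "mat_det M = subst_mpoly (\<lambda>ij. M $$ ij) (general_det (dim_row M))"

definition mat_comatrix :: "'a :: comm_ring_1 mat \<Rightarrow> 'a mat" where
  "mat_comatrix M = map_mat (subst_mpoly (\<lambda>ij. M $$ ij)) (general_comatrix (dim_row M))"

end

theory Submission
  imports Defs "Jordan_Normal_Form.Determinant" "HOL-Computational_Algebra.Polynomial_Factorial"
begin

text \<open>
  The general determinant and comatrix are defined by cancelling common factors in the inverse of
  the matrix \<open>A\<close> of variables. The point of the proof is that they coincide with the Leibniz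
  determinant \<open>det A\<close> and the adjugate \<open>adj_mat A\<close>: once this is known, (i) is the multiplicativity
  of \<open>det\<close>, and (ii) is a computation with block matrices.

  Certainly \<open>adj_mat A / det A\<close> is the inverse. It is reduced (\<open>adj_gen_coprime\<close>) because the
  \<open>i\<close>-th diagonal cofactor contains no variable of row \<open>i\<close>, so that a common factor of all of them
  is constant.

  It is the only reduced expression (\<open>reduced_expression_unique\<close>). This would follow from
  unique factorization in the polynomial ring, but a more elementary argument suffices. If
  \<open>N / d\<close> is another expression, then \<open>det A\<close> divides \<open>d\<close> times each diagonal cofactor, and it must
  be shown that \<open>det A\<close> divides \<open>d\<close>. Count degrees in the diagonal variables only. The
  top part of \<open>det A\<close> is the product of the diagonal variables, and the top part of the \<open>i\<close>-th
  cofactor is the same product without the \<open>i\<close>-th variable. Hence the \<open>i\<close>-th diagonal variable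
  divides the top part of \<open>d\<close>, for every \<open>i\<close>; so the top part of \<open>det A\<close> divides that of \<open>d\<close>, and
  division with descent on the degree finishes the argument (\<open>dvd_of_lead_coeffs\<close>, \<open>det_gen_dvd\<close>).

  In (ii), the right-hand side times the block matrix is its determinant times the identity. This
  determines the adjugate if the determinant can be cancelled, which is the case for blocks of
  variables; all other cases arise by substitution (\<open>block_triangular\<close>).
\<close>

section \<open>Substitution into integer polynomials\<close>

definition monomial_val :: "('v \<Rightarrow> 'a :: comm_ring_1) \<Rightarrow> ('v \<Rightarrow>\<^sub>0 nat) \<Rightarrow> 'a" where
  "monomial_val x m = (\<Prod>v\<in>Poly_Mapping.keys m. x v ^ Poly_Mapping.lookup m v)"

lemma monomial_val_superset:
  assumes "finite S" "Poly_Mapping.keys m \<subseteq> S"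
  shows "monomial_val x m = (\<Prod>v\<in>S. x v ^ Poly_Mapping.lookup m v)"
  unfolding monomial_val_def
  by (rule prod.mono_neutral_left) (use assms in \<open>auto simp: in_keys_iff\<close>)

lemma monomial_val_add: "monomial_val x (m + m') = monomial_val x m * monomial_val x m'"
proof -
  let ?S = "Poly_Mapping.keys m \<union> Poly_Mapping.keys m'"
  have S: "finite ?S" by simp
  show ?thesis
    using keys_add[of m m']
    by (simp add: monomial_val_superset[OF S] lookup_add power_add prod.distrib)
qed

lemma monomial_val_single [simp]: "monomial_val x (Poly_Mapping.single v k) = x v ^ k"
  by (cases "k = 0") (simp_all add: monomial_val_def)

lemma subst_mpoly_superset:
  assumes "finite S" "Poly_Mapping.keys f \<subseteq> S"
  shows "subst_mpoly x f = (\<Sum>m\<in>S. of_int (Poly_Mapping.lookup f m) * monomial_val x m)"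
  unfolding subst_mpoly_def monomial_val_def
  by (rule sum.mono_neutral_left) (use assms in \<open>auto simp: in_keys_iff\<close>)

lemma subst_mpoly_single [simp]:
  "subst_mpoly x (Poly_Mapping.single m c) = of_int c * monomial_val x m"
  by (subst subst_mpoly_superset[of "{m}"]) auto

lemma subst_mpoly_add: "subst_mpoly x (f + g) = subst_mpoly x f + subst_mpoly x g"
proof -
  let ?S = "Poly_Mapping.keys f \<union> Poly_Mapping.keys g"
  have S: "finite ?S" by simp
  show ?thesis
    using keys_add[of f g]
    by (simp add: subst_mpoly_superset[OF S] lookup_add distrib_right sum.distrib)
qed

lemma mpoly_induct [case_names single add]:
  fixes f :: "'v int_mpoly"
  assumes "\<And>m c. P (Poly_Mapping.single m c)" "\<And>f g. P f \<Longrightarrow> P g \<Longrightarrow> P (f + g)"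
  shows "P f"
proof (induction f rule: update_induct)
  case const
  show ?case using assms(1)[of 0 0] by simp
next
  case (update f m c)
  have "Poly_Mapping.update m c f = f + Poly_Mapping.single m c"
    using update.hyps by (intro poly_mapping_eqI)
      (auto simp: lookup_update lookup_add lookup_single in_keys_iff when_def)
  then show ?case using update.IH assms by metis
qed

lemma subst_mpoly_mult: "subst_mpoly x (f * g) = subst_mpoly x f * subst_mpoly x g"
proof (induction f rule: mpoly_induct)
  case (single m c)
  show ?case
    by (induction g rule: mpoly_induct)
      (simp_all add: mult_single monomial_val_add distrib_left subst_mpoly_add algebra_simps)
qed (simp add: distrib_right subst_mpoly_add)

lemma comm_ring_hom_subst_mpoly: "comm_ring_hom (subst_mpoly x)"
proof
  show "subst_mpoly x 0 = 0" by (simp add: subst_mpoly_def)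
  have "subst_mpoly x (Poly_Mapping.single 0 1) = 1"
    by (simp add: monomial_val_def del: single_one)
  then show "subst_mpoly x 1 = 1" by simp
qed (rule subst_mpoly_add subst_mpoly_mult)+

lemma subst_mpoly_Var [simp]: "subst_mpoly x (Var v) = x v"
  by (simp add: Var_def)

lemma hom_subst_mpoly:
  assumes "comm_ring_hom h"
  shows "h (subst_mpoly x f) = subst_mpoly (\<lambda>v. h (x v)) f"
proof -
  interpret comm_ring_hom h by fact
  show ?thesis by (simp add: subst_mpoly_def hom_distribs)
qed

lemma prod_single_1:
  "(\<Prod>v\<in>S. Poly_Mapping.single (g v) 1 :: 'v int_mpoly) = Poly_Mapping.single (\<Sum>v\<in>S. g v) 1"
  by (induction S rule: infinite_finite_induct) (simp_all add: mult_single)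

lemma monomial_val_Var:
  fixes m :: "'v \<Rightarrow>\<^sub>0 nat"
  shows "monomial_val Var m = Poly_Mapping.single m 1"
proof -
  have pow: "Var v ^ k = Poly_Mapping.single (Poly_Mapping.single v k) 1" for v :: 'v and k
    by (induction k) (simp_all add: Var_def mult_single flip: single_add)
  have "(\<Sum>v\<in>Poly_Mapping.keys m. Poly_Mapping.single v (Poly_Mapping.lookup m v)) = m"
    by (intro poly_mapping_eqI)
      (simp add: lookup_sum lookup_single when_def in_keys_iff sum.delta)
  then show ?thesis by (simp add: monomial_val_def pow prod_single_1)
qed

lemma of_int_mult_monomial_val:
  fixes m :: "'v \<Rightarrow>\<^sub>0 nat"
  shows "of_int c * monomial_val Var m = Poly_Mapping.single m c"
proof -
  have "of_int c = (Poly_Mapping.single 0 c :: 'v int_mpoly)"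
    using single_of_int[of c, where ?'b = int and ?'a = "'v \<Rightarrow>\<^sub>0 nat"] by simp
  then show ?thesis by (simp add: monomial_val_Var mult_single)
qed

lemma subst_mpoly_Var_id [simp]: "subst_mpoly Var f = f"
proof (induction f rule: mpoly_induct)
  case (single m c)
  show ?case by (simp add: of_int_mult_monomial_val)
qed (simp add: subst_mpoly_add)

text \<open>Polynomials preserve congruences. In particular \<open>f\<close> is congruent modulo a variable to the
  result of setting that variable to zero.\<close>
lemma subst_mpoly_cong_dvd:
  fixes x y :: "'v \<Rightarrow> 'a :: comm_ring_1"
  assumes "\<And>v. d dvd x v - y v"
  shows "d dvd subst_mpoly x f - subst_mpoly y f"
proof -
  have prod: "d dvd prod a S - prod b S" if "\<And>s. d dvd a s - b s" for a b :: "'v \<Rightarrow> 'a" and S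
  proof (induction S rule: infinite_finite_induct)
    case (insert s S)
    have "prod a (insert s S) - prod b (insert s S) =
        a s * (prod a S - prod b S) + (a s - b s) * prod b S"
      using insert.hyps by (simp add: algebra_simps)
    then show ?case using insert.IH that by simp
  qed simp_all
  have "d dvd x v ^ k - y v ^ k" for v k
    using assms[of v] by (metis dvd_trans dvd_triv_left power_diff_sumr2)
  then have "d dvd monomial_val x m - monomial_val y m" for m
    unfolding monomial_val_def by (rule prod)
  then show ?thesis
    by (auto simp: subst_mpoly_superset[OF _ subset_refl] simp flip: sum_subtractf right_diff_distrib
        intro!: dvd_sum)
qed

section \<open>Gradings\<close>

text \<open>\<open>grade w\<close> multiplies each variable \<open>v\<close> by the \<open>w v\<close>-th power of a new variable \<open>t\<close>, so that
  the coefficient of \<open>t\<close> to the \<open>k\<close> is the part of weight \<open>k\<close>. Since degrees in \<open>t\<close> add up in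
  products over a domain, a suitable weight turns divisibility into a degree count.\<close>
definition grade :: "('v \<Rightarrow> nat) \<Rightarrow> 'v int_mpoly \<Rightarrow> 'v int_mpoly poly" where
  "grade w = subst_mpoly (\<lambda>v. monom (Var v) (w v))"

lemma comm_ring_hom_grade: "comm_ring_hom (grade w)"
  unfolding grade_def by (rule comm_ring_hom_subst_mpoly)

lemma grade_Var [simp]: "grade w (Var v) = monom (Var v) (w v)"
  by (simp add: grade_def)

text \<open>Putting \<open>t = 1\<close> undoes the grading; hence every grading is injective.\<close>
lemma poly_grade_1 [simp]:
  fixes f :: "'v int_mpoly"
  shows "poly (grade w f) 1 = f"
proof -
  have "comm_ring_hom (\<lambda>p :: 'v int_mpoly poly. poly p 1)"
    by (unfold_locales) auto
  from hom_subst_mpoly[OF this, of "\<lambda>v. monom (Var v) (w v)" f] show ?thesis by (simp add: grade_def poly_monom)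
qed

lemma grade_single:
  fixes m :: "'v \<Rightarrow>\<^sub>0 nat"
  shows "grade w (Poly_Mapping.single m c) =
     monom (Poly_Mapping.single m c) (\<Sum>v\<in>Poly_Mapping.keys m. w v * Poly_Mapping.lookup m v)"
proof -
  have prod: "(\<Prod>v\<in>S. monom (a v) (k v)) = monom (\<Prod>v\<in>S. a v) (\<Sum>v\<in>S. k v)"
    for a :: "'v \<Rightarrow> 'v int_mpoly" and k S
    by (induction S rule: infinite_finite_induct) (simp_all add: mult_monom)
  have "of_int c * monom (monomial_val Var m) k = monom (of_int c * monomial_val Var m) k" for k
    by (simp add: of_int_poly smult_monom)
  then show ?thesis
    by (simp add: grade_def monomial_val_def monom_power prod)
      (simp add: of_int_mult_monomial_val flip: monomial_val_def)
qed

lemma lookup_coeff_grade: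
  "Poly_Mapping.lookup (coeff (grade w f) k) m =
     (if k = (\<Sum>v\<in>Poly_Mapping.keys m. w v * Poly_Mapping.lookup m v)
      then Poly_Mapping.lookup f m else 0)"
proof (induction f rule: mpoly_induct)
  case (single m c)
  show ?case by (auto simp: grade_single lookup_single when_def)
next
  case (add f g)
  then show ?case by (simp add: grade_def subst_mpoly_add lookup_add)
qed

text \<open>The part of weight \<open>k\<close> is homogeneous of weight \<open>k\<close>.\<close>
lemma grade_coeff: "grade w (coeff (grade w f) k) = monom (coeff (grade w f) k) k"
  by (intro poly_eqI poly_mapping_eqI) (simp add: lookup_coeff_grade)

text \<open>Give weight 1 to the variables outside \<open>V\<close>: a polynomial avoids them iff it has weight 0, that
  is, iff the grading leaves it unchanged. In this form the property is visibly stable under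
  polynomial operations.\<close>
lemma vars_subset_iff_grade:
  "mpoly_vars f \<subseteq> V \<longleftrightarrow> grade (\<lambda>v. of_bool (v \<notin> V)) f = [:f:]"
    (is "_ \<longleftrightarrow> grade ?w f = _")
proof
  assume sub: "mpoly_vars f \<subseteq> V"
  have "Poly_Mapping.lookup (coeff (grade ?w f) k) m = Poly_Mapping.lookup (coeff [:f:] k) m" for k m
  proof (cases "m \<in> Poly_Mapping.keys f")
    case True
    then have "(\<Sum>v\<in>Poly_Mapping.keys m. ?w v * Poly_Mapping.lookup m v) = 0"
      using sub by (auto simp: mpoly_vars_def)
    then show ?thesis by (simp add: lookup_coeff_grade coeff_pCons split: nat.split)
  qed (simp add: lookup_coeff_grade coeff_pCons in_keys_iff split: nat.split)
  then show "grade ?w f = [:f:]" by (intro poly_eqI poly_mapping_eqI)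
next
  assume eq: "grade ?w f = [:f:]"
  show "mpoly_vars f \<subseteq> V"
  proof
    fix v assume "v \<in> mpoly_vars f"
    then obtain m where m: "m \<in> Poly_Mapping.keys f" "v \<in> Poly_Mapping.keys m"
      by (auto simp: mpoly_vars_def)
    have "0 = (\<Sum>v\<in>Poly_Mapping.keys m. ?w v * Poly_Mapping.lookup m v)"
      using lookup_coeff_grade[of ?w f 0 m] m(1) by (auto simp: eq in_keys_iff split: if_splits)
    then have "?w v * Poly_Mapping.lookup m v = 0" using m(2) by auto
    then show "v \<in> V" using m(2) by (simp add: in_keys_iff split: if_splits)
  qed
qed

text \<open>Over a domain top weights add up, so the factors of a nonzero polynomial of weight 0 have weight 0.\<close>
lemma vars_subset_dvd:
  fixes f g :: "'v :: linorder int_mpoly"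
  assumes "g dvd f" "f \<noteq> 0" "mpoly_vars f \<subseteq> V"
  shows "mpoly_vars g \<subseteq> V"
proof -
  let ?w = "\<lambda>v. of_bool (v \<notin> V) :: nat"
  interpret g: comm_ring_hom "grade ?w" by (rule comm_ring_hom_grade)
  obtain h where h: "f = g * h" using assms(1) by (auto elim: dvdE)
  have eq: "grade ?w g * grade ?w h = [:f:]"
    using assms(3) h by (simp add: vars_subset_iff_grade g.hom_mult)
  then have nz: "grade ?w g \<noteq> 0" "grade ?w h \<noteq> 0" using assms(2) by auto
  have "degree (grade ?w g) + degree (grade ?w h) = 0"
    using degree_mult_eq[OF nz] eq by simp
  then obtain c where c: "grade ?w g = [:c:]"
    by (metis add_eq_0_iff_both_eq_0 degree_eq_zeroE)
  have "c = g" using poly_grade_1[of ?w g] c by simp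
  then show ?thesis using c by (simp add: vars_subset_iff_grade)
qed

text \<open>On a matrix with entries of weight 0 the grading acts as the inclusion of constants, and both
  ring homomorphisms commute with the determinant.\<close>
lemma vars_det:
  fixes M :: "'v int_mpoly mat"
  assumes M: "M \<in> carrier_mat n n" "\<And>i j. i < n \<Longrightarrow> j < n \<Longrightarrow> mpoly_vars (M $$ (i, j)) \<subseteq> V"
  shows "mpoly_vars (det M) \<subseteq> V"
proof -
  let ?w = "\<lambda>v. of_bool (v \<notin> V) :: nat"
  interpret g: comm_ring_hom "grade ?w" by (rule comm_ring_hom_grade)
  interpret c: comm_ring_hom "\<lambda>f. [:f:] :: 'v int_mpoly poly"
    by unfold_locales (auto simp: one_pCons)
  have "map_mat (grade ?w) M = map_mat (\<lambda>f. [:f:]) M"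
    by (rule eq_matI) (use M in \<open>auto simp: vars_subset_iff_grade\<close>)
  then have "grade ?w (det M) = [:det M:]" by (metis g.hom_det c.hom_det)
  then show ?thesis by (simp add: vars_subset_iff_grade)
qed

lemma vars_Var: "mpoly_vars (Var v) = {v}"
  by (simp add: mpoly_vars_def Var_def)

lemma Var_nonzero: "Var v \<noteq> 0"
  by (simp add: Var_def)

text \<open>Each variable is prime, because setting it to zero maps into a domain and has a kernel generated
  by that variable; and it does not divide the other variables. So the variables can be divided
  out one after the other.\<close>
lemma prod_Var_dvd:
  fixes f :: "'v :: linorder int_mpoly"
  assumes "finite S" "\<And>v. v \<in> S \<Longrightarrow> Var v dvd f"
  shows "(\<Prod>v\<in>S. Var v) dvd f"
  using assms
proof (induction S)
  case (insert v S)
  then obtain h where h: "f = (\<Prod>v\<in>S. Var v) * h" by (auto elim: dvdE)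
  let ?x = "Var(v := 0)"
  interpret s: comm_ring_hom "subst_mpoly ?x" by (rule comm_ring_hom_subst_mpoly)
  have S: "subst_mpoly ?x (\<Prod>v\<in>S. Var v) = (\<Prod>v\<in>S. Var v)"
    using insert.hyps by (auto simp: s.hom_prod intro!: prod.cong)
  have "subst_mpoly ?x f = 0"
    using insert.prems[of v] by (auto elim!: dvdE simp: s.hom_mult)
  then have "subst_mpoly ?x h = 0"
    using S by (auto simp: h s.hom_mult Var_nonzero insert.hyps)
  moreover have "Var v dvd subst_mpoly Var h - subst_mpoly ?x h"
    by (rule subst_mpoly_cong_dvd) auto
  ultimately have "Var v dvd h" by simp
  then show ?case using insert.hyps h by (simp add: mult.commute[of "Var v"] mult_dvd_mono)
qed simp

section \<open>A matrix with linear diagonal and constant off-diagonal entries\<close>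

text \<open>This is the shape of the general matrix when the diagonal variables get weight 1 and the others
  weight 0. The Leibniz term of a permutation then has degree at most its number of fixed points,
  so the product of the diagonal strictly dominates all other terms.\<close>
locale linear_diagonal =
  fixes n :: nat and x :: "nat \<Rightarrow> 'a :: idom" and M :: "'a poly mat"
  assumes carrier: "M \<in> carrier_mat n n"
    and diag: "\<And>i. i < n \<Longrightarrow> M $$ (i, i) = monom (x i) 1"
    and off_diag: "\<And>i j. i < n \<Longrightarrow> j < n \<Longrightarrow> i \<noteq> j \<Longrightarrow> degree (M $$ (i, j)) = 0"
begin

lemma degree_leibniz_term:
  assumes p: "p permutes {0..<n}" "p \<noteq> id"
  shows "degree (\<Prod>i=0..<n. M $$ (i, p i)) < n"
proof -
  obtain i where i: "i < n" "p i \<noteq> i"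
    using p by (metis atLeastLessThan_iff eq_id_iff permutes_not_in zero_le)
  have pn: "p j < n" if "j < n" for j using permutes_in_image[OF p(1)] that by simp
  have le: "degree (M $$ (j, p j)) \<le> 1" if "j < n" for j
    using that pn[of j] diag[of j] off_diag[of j "p j"] degree_monom_le[of "x j" 1]
    by (cases "p j = j") auto
  have "degree (\<Prod>j=0..<n. M $$ (j, p j)) \<le> (\<Sum>j=0..<n. degree (M $$ (j, p j)))"
    using degree_prod_sum_le[of "{0..<n}" "\<lambda>j. M $$ (j, p j)"] by (simp add: comp_def)
  also have "\<dots> < (\<Sum>j=0..<n. 1)"
    by (rule sum_strict_mono_strong[of _ i]) (use i le off_diag[of i "p i"] pn in auto)
  finally show ?thesis by simp
qed

lemma degree_det_le: "degree (det M) \<le> n"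
  and coeff_det: "coeff (det M) n = (\<Prod>i<n. x i)"
proof -
  let ?t = "\<lambda>p. \<Prod>i=0..<n. M $$ (i, p i)"
  let ?S = "{p. p permutes {0..<n}}"
  have det: "det M = (\<Sum>p\<in>?S. signof p * ?t p)"
    using carrier by (rule det_def')
  have coeff: "coeff (signof p * ?t p) k = of_int (sign p) * coeff (?t p) k" for p k
    by (cases p rule: sign_cases) auto
  have prod: "(\<Prod>i\<in>S. monom (x i) 1) = monom (prod x S) (card S)" if "finite S" for S
    using that by induction (simp_all add: mult_monom)
  have id: "?t id = monom (\<Prod>i<n. x i) n"
    using prod[of "{..<n}"] by (simp add: diag atLeast0LessThan)
  have "coeff (det M) n = (\<Sum>p\<in>?S. if p = id then of_int (sign p) * coeff (?t p) n else 0)"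
    unfolding det coeff_sum coeff
    by (intro sum.cong refl) (auto intro!: coeff_eq_0 degree_leibniz_term)
  also have "\<dots> = coeff (?t id) n"
    by (simp add: sum.delta permutes_id finite_permutations)
  finally show "coeff (det M) n = (\<Prod>i<n. x i)" unfolding id by simp
  have "degree (?t p) \<le> n" if "p \<in> ?S" for p
    using degree_leibniz_term[of p] that degree_monom_le id by (cases "p = id") force+
  then have "coeff (signof p * ?t p) k = 0" if "n < k" "p \<in> ?S" for p k
    unfolding coeff using that coeff_eq_0[of "?t p" k] le_less_trans by fastforce
  then show "degree (det M) \<le> n"
    unfolding det by (intro degree_le allI impI) (simp add: coeff_sum)
qed

text \<open>Deleting row and column \<open>i\<close> preserves the shape, so the diagonal cofactors are
  dominated by their diagonal products as well.\<close>
lemma linear_diagonal_delete: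
  assumes "i < n"
  shows "linear_diagonal (n - 1) (\<lambda>j. x (insert_index i j)) (mat_delete M i i)"
proof
  show "mat_delete M i i \<in> carrier_mat (n - 1) (n - 1)"
    using carrier by (rule mat_delete_carrier)
  fix j assume j: "j < n - 1"
  show "mat_delete M i i $$ (j, j) = monom (x (insert_index i j)) 1"
    using carrier j by (auto simp: mat_delete_def insert_index_def diag)
  fix k assume k: "k < n - 1" "j \<noteq> k"
  then show "degree (mat_delete M i i $$ (j, k)) = 0"
    using carrier j by (auto simp: mat_delete_def intro!: off_diag)
qed

lemma degree_adj_le:
  assumes "i < n"
  shows "degree (adj_mat M $$ (i, i)) \<le> n - 1"
proof -
  interpret D: linear_diagonal "n - 1" "\<lambda>j. x (insert_index i j)" "mat_delete M i i"
    by (rule linear_diagonal_delete) fact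
  show ?thesis using carrier assms D.degree_det_le by (simp add: adj_mat_def cofactor_def)
qed

lemma coeff_adj:
  assumes "i < n"
  shows "coeff (adj_mat M $$ (i, i)) (n - 1) = (\<Prod>j\<in>{..<n} - {i}. x j)"
proof -
  interpret D: linear_diagonal "n - 1" "\<lambda>j. x (insert_index i j)" "mat_delete M i i"
    by (rule linear_diagonal_delete) fact
  have "insert_index i ` {..<n - 1} = {..<n} - {i}"
    using insert_index_image[of i "n - 1"] assms by (simp add: atLeast0LessThan)
  then have "(\<Prod>j\<in>{..<n} - {i}. x j) = (\<Prod>j<n - 1. x (insert_index i j))"
    using prod.reindex[OF insert_index_inj_on[of i "{..<n - 1}"], of x] by (simp add: comp_def)
  then show ?thesis using carrier assms D.coeff_det by (simp add: adj_mat_def cofactor_def)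
qed

lemma lead_coeff_det:
  assumes "\<And>i. i < n \<Longrightarrow> x i \<noteq> 0"
  shows "degree (det M) = n" "lead_coeff (det M) = (\<Prod>i<n. x i)"
proof -
  have "(\<Prod>i<n. x i) \<noteq> 0" using assms by simp
  then show "degree (det M) = n"
    by (intro antisym[OF degree_det_le] le_degree) (simp add: coeff_det)
  then show "lead_coeff (det M) = (\<Prod>i<n. x i)" by (simp add: coeff_det)
qed

lemma lead_coeff_adj:
  assumes "\<And>i. i < n \<Longrightarrow> x i \<noteq> 0" "i < n"
  shows "lead_coeff (adj_mat M $$ (i, i)) = (\<Prod>j\<in>{..<n} - {i}. x j)"
proof -
  have nz: "(\<Prod>j\<in>{..<n} - {i}. x j) \<noteq> 0" using assms by simp
  have "degree (adj_mat M $$ (i, i)) = n - 1"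
    by (intro antisym[OF degree_adj_le[OF assms(2)]] le_degree) (simp only: coeff_adj[OF assms(2)] nz not_False_eq_True)
  then show ?thesis by (simp only: coeff_adj[OF assms(2)])
qed

end

text \<open>A division argument that replaces unique factorization. Suppose that the leading coefficient of
  \<open>D\<close> is the product of all \<open>x i\<close> and the one of \<open>a i\<close> is the product without \<open>x i\<close>. If \<open>D\<close>
  divides \<open>f * a i\<close>, comparing leading coefficients and cancelling shows that \<open>x i\<close> divides the
  leading coefficient of \<open>f\<close>. When this holds for all \<open>i\<close>, independence of the \<open>x i\<close> makes the
  leading coefficient of \<open>D\<close> divide that of \<open>f\<close>, so a multiple of \<open>D\<close> can be subtracted to
  lower the degree. Homogeneity guarantees that this multiple has exactly the degree of \<open>f\<close>.\<close>
lemma dvd_of_lead_coeffs: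
  fixes x a :: "nat \<Rightarrow> 'a :: idom" and \<phi> :: "'a \<Rightarrow> 'a poly"
  assumes hom: "inj_comm_ring_hom \<phi>"
    and homogeneous: "\<And>f. \<phi> (lead_coeff (\<phi> f)) = monom (lead_coeff (\<phi> f)) (degree (\<phi> f))"
    and x: "\<And>i. i < n \<Longrightarrow> x i \<noteq> 0" "\<And>i. i < n \<Longrightarrow> \<phi> (x i) = monom (x i) 1"
    and indep: "\<And>f. (\<And>i. i < n \<Longrightarrow> x i dvd f) \<Longrightarrow> (\<Prod>i<n. x i) dvd f"
    and D: "degree (\<phi> D) = n" "lead_coeff (\<phi> D) = (\<Prod>i<n. x i)"
    and a: "\<And>i. i < n \<Longrightarrow> lead_coeff (\<phi> (a i)) = (\<Prod>j\<in>{..<n} - {i}. x j)"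
    and dvd: "\<And>i. i < n \<Longrightarrow> D dvd f * a i"
  shows "D dvd f"
  using dvd
proof (induction "degree (\<phi> f)" arbitrary: f rule: less_induct)
  case less
  interpret inj_comm_ring_hom \<phi> by (fact hom)
  let ?P = "\<Prod>i<n. x i" and ?k = "degree (\<phi> f)" and ?l = "lead_coeff (\<phi> f)"
  have P: "?P \<noteq> 0" using x(1) by simp
  have "x i dvd ?l" if i: "i < n" for i
  proof -
    let ?Q = "\<Prod>j\<in>{..<n} - {i}. x j"
    have Q: "?Q \<noteq> 0" using x(1) by simp
    obtain h where "f * a i = D * h" using less.prems[OF i] by (auto elim: dvdE)
    then have "\<phi> f * \<phi> (a i) = \<phi> D * \<phi> h" by (metis hom_mult)
    then have "?l * ?Q = ?P * lead_coeff (\<phi> h)"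
      by (metis lead_coeff_mult D(2) a[OF i])
    also have "?P = x i * ?Q" using i by (simp add: prod.remove)
    finally have "?l = x i * lead_coeff (\<phi> h)" using Q by simp
    then show ?thesis by simp
  qed
  then have "?P dvd ?l" by (rule indep)
  then obtain c where c: "?l = ?P * c" by (auto elim: dvdE)
  show ?case
  proof (cases "f = 0")
    case False
    then have c0: "c \<noteq> 0" using c by auto
    have monoms: "(\<Prod>i\<in>S. monom (x i) 1) = monom (prod x S) (card S)" if "finite S" for S
      using that by induction (simp_all add: mult_monom)
    \<comment> \<open>The leading coefficient \<open>?P * c\<close> is homogeneous of weight \<open>?k\<close>, and \<open>?P\<close> is of weight \<open>n\<close>;
      hence \<open>c\<close> is homogeneous of weight \<open>?k - n\<close>.\<close>
    have "\<phi> ?P = monom ?P n"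
      using x(2) monoms[of "{..<n}"] by (simp add: hom_prod)
    then have eq: "monom ?P n * \<phi> c = monom (?P * c) ?k"
      using homogeneous[of f] by (simp add: c hom_mult)
    then have "n + degree (\<phi> c) = ?k"
      using degree_mult_eq[of "monom ?P n" "\<phi> c"] P c0 by (simp add: degree_monom_eq)
    then have k: "n \<le> ?k" by simp
    have "monom ?P n * \<phi> c = monom ?P n * monom c (?k - n)"
      unfolding eq using k by (simp add: mult_monom)
    then have \<phi>c: "\<phi> c = monom c (?k - n)" using P by simp
    let ?g = "f - c * D"
    have \<phi>g: "\<phi> ?g = \<phi> f - monom c (?k - n) * \<phi> D"
      by (simp add: hom_minus hom_mult \<phi>c)
    have "degree (monom c (?k - n) * \<phi> D) \<le> ?k"
      using degree_mult_le[of "monom c (?k - n)" "\<phi> D"] degree_monom_le[of c "?k - n"] D(1) k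
      by linarith
    then have le: "degree (\<phi> ?g) \<le> ?k"
      unfolding \<phi>g by (intro degree_diff_le) simp_all
    have "coeff (monom c (?k - n) * \<phi> D) ?k = c * lead_coeff (\<phi> D)"
      using k D(1) by (simp add: coeff_monom_mult)
    then have coeff: "coeff (\<phi> ?g) ?k = 0"
      unfolding \<phi>g using c D(2) by simp
    have g_dvd: "D dvd ?g * a i" if "i < n" for i
      using less.prems[OF that] by (simp add: left_diff_distrib)
    have "D dvd ?g"
    proof (cases "?g = 0")
      case False
      then have "lead_coeff (\<phi> ?g) \<noteq> 0" by simp
      with coeff have "degree (\<phi> ?g) \<noteq> ?k" by metis
      with le have "degree (\<phi> ?g) < ?k" by simp
      then show ?thesis using g_dvd by (rule less.hyps)
    qed simp
    then have "D dvd ?g + c * D" by (intro dvd_add dvd_triv_right)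
    then show ?thesis by (simp only: diff_add_cancel)
  qed simp
qed

section \<open>The reduced expression of the inverse of the general matrix\<close>

abbreviation gen :: "nat \<Rightarrow> (nat \<times> nat) int_mpoly mat" where
  "gen n \<equiv> general_mat n n (\<lambda>ij. ij)"

lemma gen_carrier [simp]: "gen n \<in> carrier_mat n n"
  by (simp add: general_mat_def)

lemma gen_dim [simp]: "dim_row (gen n) = n" "dim_col (gen n) = n"
  by (simp_all add: general_mat_def)

lemma adj_gen_carrier [simp]: "adj_mat (gen n) \<in> carrier_mat n n"
  by (rule adj_mat(1)) simp

lemma gen_index [simp]: "i < n \<Longrightarrow> j < n \<Longrightarrow> gen n $$ (i, j) = Var (i, j)"
  by (simp add: general_mat_def)

lemma map_subst_gen:
  assumes "M \<in> carrier_mat n n"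
  shows "map_mat (subst_mpoly (\<lambda>ij. M $$ ij)) (gen n) = M"
  by (rule eq_matI) (use assms in \<open>auto simp: general_mat_def\<close>)

lemma (in comm_ring_hom) hom_mat_delete: "map_mat hom (mat_delete M i j) = mat_delete (map_mat hom M) i j"
  by (rule eq_matI) (auto simp: mat_delete_def)

lemma (in comm_ring_hom) hom_adj_mat:
  assumes "M \<in> carrier_mat n n"
  shows "adj_mat (map_mat hom M) = map_mat hom (adj_mat M)"
  by (rule eq_matI)
    (use assms in \<open>auto simp: adj_mat_def cofactor_def hom_distribs simp flip: hom_mat_delete\<close>)

lemma eval_Id_det_gen: "eval_Id (det (gen n)) = 1"
proof -
  interpret comm_ring_hom eval_Id unfolding eval_Id_def by (rule comm_ring_hom_subst_mpoly)
  have "map_mat eval_Id (gen n) = 1\<^sub>m n"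
    by (rule eq_matI) (auto simp: general_mat_def eval_Id_def)
  then show ?thesis using hom_det[of "gen n"] by simp
qed

lemma eval_Id_adj_gen:
  assumes "i < n"
  shows "eval_Id (adj_mat (gen n) $$ (i, i)) = 1"
proof -
  interpret comm_ring_hom eval_Id unfolding eval_Id_def by (rule comm_ring_hom_subst_mpoly)
  have "map_mat eval_Id (mat_delete (gen n) i i) = 1\<^sub>m (n - 1)"
    by (rule eq_matI) (auto simp: general_mat_def mat_delete_def eval_Id_def)
  then have "eval_Id (det (mat_delete (gen n) i i)) = 1"
    using hom_det[of "mat_delete (gen n) i i"] by simp
  then show ?thesis using assms
    by (simp add: adj_mat_def cofactor_def general_mat_def)
qed

lemma eval_Id_0: "eval_Id 0 = 0"
  by (simp add: eval_Id_def subst_mpoly_def)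

lemma det_gen_nonzero: "det (gen n) \<noteq> 0"
  using eval_Id_det_gen[of n] eval_Id_0 by auto

lemma det_gen_Lambda: "det (gen n) \<in> Lambda n"
  unfolding Lambda_def mem_Collect_eq
  by (rule vars_det[of _ n]) (auto simp: vars_Var indices_def)

text \<open>The entry \<open>(i, j)\<close> of the adjugate is the cofactor at \<open>(j, i)\<close>, for which row \<open>j\<close> is deleted.\<close>
lemma vars_adj_gen:
  assumes "i < n" "j < n"
  shows "mpoly_vars (adj_mat (gen n) $$ (i, j)) \<subseteq> indices n n - {j} \<times> UNIV"
proof -
  have "mpoly_vars (det (mat_delete (gen n) j i)) \<subseteq> indices n n - {j} \<times> UNIV"
    by (rule vars_det[of _ "n - 1"])
      (auto simp: mat_delete_def general_mat_def vars_Var indices_def split: if_splits)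
  moreover have "mpoly_vars ((-1) ^ k * f) = mpoly_vars f" for k and f :: "(nat \<times> nat) int_mpoly"
    by (cases "even k") (auto simp: mpoly_vars_def)
  ultimately show ?thesis
    using assms by (simp add: adj_mat_def cofactor_def general_mat_def)
qed

lemma of_no_vars:
  assumes "mpoly_vars g = {}"
  shows "g = of_int (eval_Id g)"
proof -
  have "subst_mpoly x g = of_int (Poly_Mapping.lookup g 0)" for x :: "nat \<times> nat \<Rightarrow> 'a :: comm_ring_1"
  proof -
    have "Poly_Mapping.keys g \<subseteq> {0}" using assms by (auto simp: mpoly_vars_def)
    then show ?thesis by (subst subst_mpoly_superset[of "{0}"]) (auto simp: monomial_val_def)
  qed
  note const = this
  have "eval_Id g = Poly_Mapping.lookup g 0"
    unfolding eval_Id_def by (subst const) simp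
  then show ?thesis using const[of Var] by simp
qed

lemma unit_of_no_vars:
  assumes "mpoly_vars g = {}" "eval_Id g dvd 1"
  shows "g dvd 1"
proof -
  obtain c where "eval_Id g * c = 1" using assms(2) by (metis dvdE)
  then have "of_int (eval_Id g) * of_int c = (1 :: (nat \<times> nat) int_mpoly)"
    by (simp flip: of_int_mult)
  then show ?thesis by (metis of_no_vars[OF assms(1)] dvd_triv_left)
qed

text \<open>A common factor divides every diagonal cofactor, hence involves the variables of no row at all.
  It is then an integer, which divides the value 1 of the determinant at the identity.\<close>
lemma adj_gen_coprime:
  assumes "g \<in> Lambda n" "g dvd det (gen n)" "\<And>i. i < n \<Longrightarrow> g dvd adj_mat (gen n) $$ (i, i)"
  shows "g dvd 1"
proof (rule unit_of_no_vars)
  interpret comm_ring_hom eval_Id unfolding eval_Id_def by (rule comm_ring_hom_subst_mpoly)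
  have "mpoly_vars g \<subseteq> indices n n - {i} \<times> UNIV" if "i < n" for i
  proof (rule vars_subset_dvd)
    show "adj_mat (gen n) $$ (i, i) \<noteq> 0" using eval_Id_adj_gen[OF that] eval_Id_0 by auto
  qed (use assms(3) vars_adj_gen that in auto)
  then show "mpoly_vars g = {}"
    using assms(1) by (fastforce simp: Lambda_def indices_def)
  show "eval_Id g dvd 1"
    using assms(2) eval_Id_det_gen[of n] by (metis dvd_def hom_mult)
qed

lemma comm_ring_hom_to_fract: "comm_ring_hom to_fract"
  by unfold_locales simp_all

lemma general_inverse_eq:
  "general_inverse n = map_mat (\<lambda>f. Fraction_Field.Fract f (det (gen n))) (adj_mat (gen n))"
    (is "_ = ?X")
proof -
  interpret to_fract: comm_ring_hom to_fract by (rule comm_ring_hom_to_fract)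
  let ?D = "to_fract (det (gen n))"
  let ?A = "map_mat to_fract (gen n)" and ?A' = "map_mat to_fract (adj_mat (gen n))"
  have D: "?D \<noteq> 0" using det_gen_nonzero by simp
  have X: "?X = inverse ?D \<cdot>\<^sub>m ?A'"
    by (rule eq_matI) (simp_all add: to_fract_def)
  have cancel: "inverse ?D \<cdot>\<^sub>m (?D \<cdot>\<^sub>m 1\<^sub>m n) = 1\<^sub>m n"
    by (rule eq_matI) (simp_all add: left_inverse[OF D] del: to_fract_eq_0_iff)
  have A: "?A \<in> carrier_mat n n" and A': "?A' \<in> carrier_mat n n" by simp_all
  have one: "map_mat to_fract (det (gen n) \<cdot>\<^sub>m 1\<^sub>m n) = ?D \<cdot>\<^sub>m 1\<^sub>m n"
    by (rule eq_matI) simp_all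
  have "?A * ?A' = ?D \<cdot>\<^sub>m 1\<^sub>m n"
    by (simp only: one adj_mat(2)[OF gen_carrier]
        flip: to_fract.mat_hom_mult[OF gen_carrier adj_gen_carrier])
  then have right: "?A * ?X = 1\<^sub>m n"
    unfolding X mult_smult_distrib[OF A A'] by (simp only: cancel)
  have "?A' * ?A = ?D \<cdot>\<^sub>m 1\<^sub>m n"
    by (simp only: one adj_mat(3)[OF gen_carrier]
        flip: to_fract.mat_hom_mult[OF adj_gen_carrier gen_carrier])
  then have left: "?X * ?A = 1\<^sub>m n"
    unfolding X mult_smult_assoc_mat[OF A' A] by (simp only: cancel)
  have "?X \<in> carrier_mat n n" by simp
  then have "inv\<^bsub>ring_mat TYPE((nat \<times> nat) int_mpoly fract) n ()\<^esub> ?A = ?X"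
    using left right A
    by (intro monoid.inv_char ring.is_monoid ring_mat) (simp_all add: ring_mat_simps)
  moreover have "(\<lambda>f. Fraction_Field.Fract f 1) = (to_fract :: (nat \<times> nat) int_mpoly \<Rightarrow> _)"
    by (simp add: fun_eq_iff to_fract_def)
  ultimately show ?thesis unfolding general_inverse_def by simp
qed

text \<open>This makes denominators of the inverse comparable without unique factorization. All diagonal
  cofactors enter, because the \<open>i\<close>-th one only forces the \<open>i\<close>-th diagonal variable into the top
  part of \<open>f\<close>.\<close>
lemma det_gen_dvd:
  assumes dvd: "\<And>i. i < n \<Longrightarrow> det (gen n) dvd f * adj_mat (gen n) $$ (i, i)"
  shows "det (gen n) dvd f"
proof -
  define w :: "nat \<times> nat \<Rightarrow> nat" where "w = (\<lambda>(i, j). of_bool (i = j))"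
  interpret hom: comm_ring_hom "grade w" by (rule comm_ring_hom_grade)
  have inj: "inj_comm_ring_hom (grade w)"
    by unfold_locales (metis poly_0 poly_grade_1)
  let ?x = "\<lambda>i. Var (i, i) :: (nat \<times> nat) int_mpoly"
  interpret linear_diagonal n ?x "map_mat (grade w) (gen n)"
    by unfold_locales (auto simp: w_def monom_0)
  have entry: "adj_mat (map_mat (grade w) (gen n)) $$ (i, i) = grade w (adj_mat (gen n) $$ (i, i))"
    if "i < n" for i
    using that by (simp add: hom.hom_adj_mat[OF gen_carrier] carrier_matD[OF adj_gen_carrier])
  show ?thesis
  proof (rule dvd_of_lead_coeffs[OF inj, where x = ?x])
    show "grade w (lead_coeff (grade w f)) = monom (lead_coeff (grade w f)) (degree (grade w f))" for f
      by (rule grade_coeff)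
    show "(\<Prod>i<n. ?x i) dvd f" if "\<And>i. i < n \<Longrightarrow> ?x i dvd f" for f
    proof -
      have "(\<Prod>v\<in>(\<lambda>i. (i, i)) ` {..<n}. Var v) dvd f"
        by (rule prod_Var_dvd) (use that in auto)
      then show ?thesis by (simp add: prod.reindex inj_on_def)
    qed
    show "degree (grade w (det (gen n))) = n" "lead_coeff (grade w (det (gen n))) = (\<Prod>i<n. ?x i)"
      using lead_coeff_det by (simp_all add: Var_nonzero)
    show "lead_coeff (grade w (adj_mat (gen n) $$ (i, i))) = (\<Prod>j\<in>{..<n} - {i}. ?x j)" if "i < n" for i
      using lead_coeff_adj[OF _ that] entry[OF that] by (simp add: Var_nonzero)
  qed (use dvd in \<open>auto simp: Var_nonzero w_def\<close>)
qed

lemma reduced_expression_adj: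
  "reduced_expression n (general_inverse n) (adj_mat (gen n)) (det (gen n))"
proof -
  have entries: "elements_mat (adj_mat (gen n)) \<subseteq> Lambda n"
    using vars_adj_gen by (fastforce simp: elements_mat_def Lambda_def carrier_matD[OF adj_gen_carrier])
  have "adj_mat (gen n) $$ (i, i) \<in> elements_mat (adj_mat (gen n))" if "i < n" for i
    using that by (intro elements_matI[OF adj_gen_carrier]) auto
  then show ?thesis
    unfolding reduced_expression_def
    using entries adj_gen_coprime det_gen_Lambda eval_Id_det_gen general_inverse_eq by simp
qed

text \<open>Comparing \<open>N / d\<close> with the adjugate over the determinant gives \<open>d * adj = N * det\<close> entrywise.
  The diagonal entries of this equation yield \<open>d = det * h\<close>, whence \<open>N = h * adj\<close>. Now \<open>h\<close> is a
  common factor of \<open>N\<close> and \<open>d\<close>, so it is a unit, and positivity at the identity forces \<open>h = 1\<close>.\<close>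
lemma reduced_expression_unique:
  assumes "reduced_expression n (general_inverse n) N d"
  shows "N = adj_mat (gen n) \<and> d = det (gen n)"
proof -
  interpret comm_ring_hom eval_Id unfolding eval_Id_def by (rule comm_ring_hom_subst_mpoly)
  let ?D = "det (gen n)" and ?A = "adj_mat (gen n)"
  note red = assms[unfolded reduced_expression_def general_inverse_eq]
  have N: "N \<in> carrier_mat n n" and d: "d \<in> Lambda n" "eval_Id d > 0"
    and inv: "map_mat (\<lambda>f. Fraction_Field.Fract f ?D) ?A = map_mat (\<lambda>f. Fraction_Field.Fract f d) N"
    and coprime: "\<forall>g \<in> Lambda n. g dvd d \<and> (\<forall>f \<in> elements_mat N. g dvd f) \<longrightarrow> g dvd 1"
    using red by - (elim conjE, assumption)+
  have A: "?A \<in> carrier_mat n n" by simp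
  have d0: "d \<noteq> 0" using d(2) eval_Id_0 by auto
  have cross: "d * ?A $$ (i, j) = N $$ (i, j) * ?D" if "i < n" "j < n" for i j
    using arg_cong[OF inv, of "\<lambda>M. M $$ (i, j)"] that A N d0 det_gen_nonzero[of n]
    by (simp add: eq_fract mult.commute)
  have "?D dvd d"
    by (rule det_gen_dvd) (simp add: cross)
  then obtain h where h: "d = ?D * h" by (auto elim: dvdE)
  have Nh: "N $$ (i, j) = h * ?A $$ (i, j)" if "i < n" "j < n" for i j
    using cross[OF that] det_gen_nonzero[of n] by (simp add: h)
  have "h \<in> Lambda n"
    using vars_subset_dvd[of h d] h d0 d(1) by (simp add: Lambda_def)
  moreover have "h dvd f" if f: "f \<in> elements_mat N" for f
  proof -
    obtain i j where "f = N $$ (i, j)" "i < n" "j < n"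
      using elements_matD[OF f] N by auto
    then show ?thesis by (simp add: Nh)
  qed
  ultimately have "h dvd 1" using coprime h by simp
  then have "mpoly_vars h = {}"
    using vars_subset_dvd[of h 1 "{}"] by (simp add: mpoly_vars_def)
  moreover have "eval_Id h = 1"
  proof -
    have "eval_Id h > 0" using d(2) eval_Id_det_gen[of n] by (simp add: h hom_mult)
    moreover have "eval_Id h dvd 1" using \<open>h dvd 1\<close> by (metis dvd_def hom_mult hom_one)
    ultimately show ?thesis by simp
  qed
  ultimately have "h = 1" using of_no_vars by force
  moreover have "N = ?A"
    by (rule eq_matI) (use N Nh \<open>h = 1\<close> in \<open>auto simp: carrier_matD[OF adj_gen_carrier]\<close>)
  ultimately show ?thesis using h by simp
qed

lemma general_det_eq: "general_det n = det (gen n)"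
  unfolding general_det_def
  by (rule the_equality) (auto dest: reduced_expression_unique intro: reduced_expression_adj)

lemma general_comatrix_eq: "general_comatrix n = adj_mat (gen n)"
  unfolding general_comatrix_def
  by (rule the_equality) (auto dest: reduced_expression_unique intro: reduced_expression_adj)

lemma mat_det_eq:
  assumes "M \<in> carrier_mat n n"
  shows "mat_det M = det M"
proof -
  interpret comm_ring_hom "subst_mpoly (\<lambda>ij. M $$ ij)" by (rule comm_ring_hom_subst_mpoly)
  show ?thesis
    using assms hom_det[of "gen n"]
    by (simp add: mat_det_def general_det_eq map_subst_gen)
qed

lemma mat_comatrix_eq:
  assumes "M \<in> carrier_mat n n"
  shows "mat_comatrix M = adj_mat M"
proof -
  interpret comm_ring_hom "subst_mpoly (\<lambda>ij. M $$ ij)" by (rule comm_ring_hom_subst_mpoly)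
  show ?thesis
    using assms hom_adj_mat[OF gen_carrier, of n]
    by (simp add: mat_comatrix_def general_comatrix_eq map_subst_gen)
qed

section \<open>The adjugate of a block triangular matrix\<close>

text \<open>Multiply \<open>T * X = det T\<close> by the adjugate on the left and cancel \<open>det T\<close>.\<close>
lemma adj_mat_eqI:
  fixes T :: "'a :: idom mat"
  assumes T: "T \<in> carrier_mat n n" and X: "X \<in> carrier_mat n n"
    and TX: "T * X = det T \<cdot>\<^sub>m 1\<^sub>m n" and nz: "det T \<noteq> 0"
  shows "adj_mat T = X"
proof -
  note adj = adj_mat[OF T]
  have "det T \<cdot>\<^sub>m X = adj_mat T * T * X"
    by (simp add: adj(3) mult_smult_assoc_mat[OF one_carrier_mat X] left_mult_one_mat[OF X])
  also have "\<dots> = adj_mat T * (det T \<cdot>\<^sub>m 1\<^sub>m n)"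
    by (simp add: assoc_mult_mat[OF adj(1) T X] TX)
  also have "\<dots> = det T \<cdot>\<^sub>m adj_mat T"
    by (simp add: mult_smult_distrib[OF adj(1) one_carrier_mat] right_mult_one_mat[OF adj(1)])
  finally have eq: "det T \<cdot>\<^sub>m X = det T \<cdot>\<^sub>m adj_mat T" .
  show ?thesis
  proof (rule eq_matI)
    fix i j assume "i < dim_row X" "j < dim_col X"
    then have "det T * X $$ (i, j) = det T * adj_mat T $$ (i, j)"
      using arg_cong[OF eq, of "\<lambda>M. M $$ (i, j)"] X carrier_matD[OF adj(1)] by simp
    then show "adj_mat T $$ (i, j) = X $$ (i, j)" using nz by simp
  qed (use X carrier_matD[OF adj(1)] in auto)
qed

definition block_adj :: "'a :: comm_ring_1 mat \<Rightarrow> 'a mat \<Rightarrow> 'a mat \<Rightarrow> 'a mat" where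
  "block_adj U W V =
     four_block_mat (det V \<cdot>\<^sub>m adj_mat U) (- (adj_mat U * W * adj_mat V))
       (0\<^sub>m (dim_row V) (dim_row U)) (det U \<cdot>\<^sub>m adj_mat V)"

lemma block_mult_block_adj:
  assumes U: "U \<in> carrier_mat p p" and W: "W \<in> carrier_mat p q" and V: "V \<in> carrier_mat q q"
  shows "four_block_mat U W (0\<^sub>m q p) V * block_adj U W V = (det U * det V) \<cdot>\<^sub>m 1\<^sub>m (p + q)"
proof -
  note aU = adj_mat[OF U] and aV = adj_mat[OF V]
  have WV: "W * adj_mat V \<in> carrier_mat p q" using W aV(1) by simp
  have top_left: "U * (det V \<cdot>\<^sub>m adj_mat U) = (det U * det V) \<cdot>\<^sub>m 1\<^sub>m p"
    unfolding mult_smult_distrib[OF U aU(1)] aU(2) by (rule eq_matI) simp_all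
  have bot_right: "V * (det U \<cdot>\<^sub>m adj_mat V) = (det U * det V) \<cdot>\<^sub>m 1\<^sub>m q"
    unfolding mult_smult_distrib[OF V aV(1)] aV(2) by (rule eq_matI) simp_all
  have "U * (adj_mat U * W * adj_mat V) = U * adj_mat U * (W * adj_mat V)"
    unfolding assoc_mult_mat[OF aU(1) W aV(1)] by (rule assoc_mult_mat[OF U aU(1) WV, symmetric])
  also have "\<dots> = det U \<cdot>\<^sub>m (W * adj_mat V)"
    unfolding aU(2) mult_smult_assoc_mat[OF one_carrier_mat WV] left_mult_one_mat[OF WV] ..
  finally have "U * - (adj_mat U * W * adj_mat V) = - (det U \<cdot>\<^sub>m (W * adj_mat V))"
    using U aU(1) W by simp
  then have top_right: "U * - (adj_mat U * W * adj_mat V) + W * (det U \<cdot>\<^sub>m adj_mat V) = 0\<^sub>m p q"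
    unfolding mult_smult_distrib[OF W aV(1)] using WV by simp
  have X: "- (adj_mat U * W * adj_mat V) \<in> carrier_mat p q" using aU(1) W aV(1) by simp
  have "four_block_mat U W (0\<^sub>m q p) V * block_adj U W V =
      four_block_mat ((det U * det V) \<cdot>\<^sub>m 1\<^sub>m p) (0\<^sub>m p q) (0\<^sub>m q p) ((det U * det V) \<cdot>\<^sub>m 1\<^sub>m q)"
    unfolding block_adj_def carrier_matD(1)[OF U] carrier_matD(1)[OF V]
    by (subst mult_four_block_mat[OF U W zero_carrier_mat V
          smult_carrier_mat[OF aU(1)] X zero_carrier_mat smult_carrier_mat[OF aV(1)]])
      (use W V in \<open>simp add: top_left bot_right top_right left_mult_zero_mat[OF X]
         left_mult_zero_mat[OF smult_carrier_mat[OF aU(1)]]\<close>)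
  also have "\<dots> = (det U * det V) \<cdot>\<^sub>m four_block_mat (1\<^sub>m p) (0\<^sub>m p q) (0\<^sub>m q p) (1\<^sub>m q)"
    by (subst smult_four_block_mat[of _ p p _ q _ q]) simp_all
  finally show ?thesis by simp
qed

lemma (in comm_ring_hom) hom_block_adj:
  assumes U: "U \<in> carrier_mat p p" and W: "W \<in> carrier_mat p q" and V: "V \<in> carrier_mat q q"
  shows "map_mat hom (block_adj U W V) = block_adj (map_mat hom U) (map_mat hom W) (map_mat hom V)"
proof -
  note aU = adj_mat(1)[OF U] and aV = adj_mat(1)[OF V]
  have UWV: "adj_mat U * W * adj_mat V \<in> carrier_mat p q" using aU W aV by simp
  have smult: "map_mat hom (c \<cdot>\<^sub>m M) = hom c \<cdot>\<^sub>m map_mat hom M" for c M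
    by (rule eq_matI) (simp_all add: hom_mult)
  have neg: "map_mat hom (- M) = - map_mat hom M" for M
    by (rule eq_matI) (simp_all add: hom_uminus)
  have zero: "map_mat hom (0\<^sub>m q p) = 0\<^sub>m q p"
    by (rule eq_matI) simp_all
  show ?thesis
    unfolding block_adj_def index_map_mat carrier_matD(1)[OF U] carrier_matD(1)[OF V]
      hom_adj_mat[OF U] hom_adj_mat[OF V] hom_det
    by (subst map_four_block_mat[of _ p p _ q _ q])
      (use U V W aU aV UWV in \<open>simp_all add: smult neg zero
         mat_hom_mult[OF aU mult_carrier_mat[OF W aV]] mat_hom_mult[OF W aV]\<close>)
qed

text \<open>Both identities are polynomial in the entries. They hold for blocks of independent variables,
  where the ring is a domain and the determinant is not zero; substitution then carries them to
  arbitrary commutative rings. This detour is what gives the formula for the adjugate when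
  \<open>det U * det V\<close> is a zero divisor.\<close>
lemma block_triangular:
  fixes U V W :: "'a :: comm_ring_1 mat"
  assumes U: "U \<in> carrier_mat p p" and W: "W \<in> carrier_mat p q" and V: "V \<in> carrier_mat q q"
  shows "det (four_block_mat U W (0\<^sub>m q p) V) = det U * det V"
    and "adj_mat (four_block_mat U W (0\<^sub>m q p) V) = block_adj U W V"
proof -
  let ?u = "gen p"
  let ?w = "general_mat p q (\<lambda>(i, j). (i, p + j))"
  let ?v = "general_mat q q (\<lambda>(i, j). (p + i, p + j))"
  let ?t = "four_block_mat ?u ?w (0\<^sub>m q p) ?v" and ?T = "four_block_mat U W (0\<^sub>m q p) V"
  have u: "?u \<in> carrier_mat p p" and w: "?w \<in> carrier_mat p q" and v: "?v \<in> carrier_mat q q"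
    by (simp_all add: general_mat_def)
  have t: "?t \<in> carrier_mat (p + q) (p + q)" using four_block_carrier_mat[OF u v] .
  have det_t: "det ?t = det ?u * det ?v"
    by (rule det_four_block_mat_lower_left_zero[OF u w refl v])
  have nz: "det ?t \<noteq> 0"
  proof -
    interpret comm_ring_hom eval_Id unfolding eval_Id_def by (rule comm_ring_hom_subst_mpoly)
    have "map_mat eval_Id ?v = 1\<^sub>m q"
      by (rule eq_matI) (auto simp: general_mat_def eval_Id_def)
    then have "eval_Id (det ?v) = 1" using hom_det[of ?v] by simp
    then show ?thesis unfolding det_t using det_gen_nonzero eval_Id_0 by auto
  qed
  have block_carrier: "block_adj ?u ?w ?v \<in> carrier_mat (p + q) (p + q)"
    unfolding block_adj_def
    by (rule four_block_carrier_mat) (use adj_mat(1)[OF u] adj_mat(1)[OF v] in simp_all)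
  have adj_t: "adj_mat ?t = block_adj ?u ?w ?v"
    by (rule adj_mat_eqI[OF t block_carrier _ nz]) (simp only: det_t block_mult_block_adj[OF u w v])
  define x where "x = (\<lambda>(i, j). ?T $$ (i, j))"
  interpret comm_ring_hom "subst_mpoly x" by (rule comm_ring_hom_subst_mpoly)
  have u': "map_mat (subst_mpoly x) ?u = U"
    and w': "map_mat (subst_mpoly x) ?w = W"
    and v': "map_mat (subst_mpoly x) ?v = V"
    by (rule eq_matI; use U V W in \<open>simp add: general_mat_def x_def\<close>)+
  have t': "map_mat (subst_mpoly x) ?t = ?T"
    by (subst map_four_block_mat[OF u w zero_carrier_mat v])
      (simp only: u' w' v' , rule arg_cong2[where f = "\<lambda>z v. four_block_mat U W z v"], auto)
  show "det ?T = det U * det V"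
    using arg_cong[OF det_t, of "subst_mpoly x"]
    by (simp only: hom_mult flip: hom_det) (simp only: t' u' v')
  show "adj_mat ?T = block_adj U W V"
    using arg_cong[OF adj_t, of "map_mat (subst_mpoly x)"]
    by (simp only: hom_block_adj[OF u w v] flip: hom_adj_mat[OF t]) (simp only: t' u' w' v')
qed

lemma general_mat_carrier: "general_mat p q x \<in> carrier_mat p q"
  by (simp add: general_mat_def)

theorem mainTheorem4:
  shows "(\<forall>n \<ge> 1. \<forall>b c :: nat \<times> nat \<Rightarrow> 'v.
      inj_on b (indices n n) \<and> inj_on c (indices n n) \<and>
      b ` indices n n \<inter> c ` indices n n = {} \<longrightarrow>
      (let B = general_mat n n b; C = general_mat n n c in
        mat_det (B * C) = mat_det C * mat_det B)) \<and>
    (\<forall>p \<ge> 1. \<forall>q \<ge> 1. \<forall>u v w :: nat \<times> nat \<Rightarrow> 'v.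
      inj_on u (indices p p) \<and> inj_on v (indices q q) \<and> inj_on w (indices p q) \<and>
      u ` indices p p \<inter> v ` indices q q = {} \<and>
      u ` indices p p \<inter> w ` indices p q = {} \<and>
      v ` indices q q \<inter> w ` indices p q = {} \<longrightarrow>
      (let U = general_mat p p u; V = general_mat q q v; W = general_mat p q w;
           T = four_block_mat U W (0\<^sub>m q p) V in
        mat_det T = mat_det U * mat_det V \<and>
        mat_comatrix T =
          four_block_mat
            (mat_det V \<cdot>\<^sub>m mat_comatrix U) (- (mat_comatrix U * W * mat_comatrix V))
            (0\<^sub>m q p) (mat_det U \<cdot>\<^sub>m mat_comatrix V)))"
proof (intro conjI allI impI)
  fix n :: nat and b c :: "nat \<times> nat \<Rightarrow> 'v"
  let ?B = "general_mat n n b" and ?C = "general_mat n n c"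
  note BC = general_mat_carrier[of n n b] general_mat_carrier[of n n c]
  have "mat_det (?B * ?C) = mat_det ?C * mat_det ?B"
    by (simp add: mult.commute mat_det_eq[OF BC(1)] mat_det_eq[OF BC(2)]
        mat_det_eq[OF mult_carrier_mat[OF BC]] det_mult[OF BC])
  then show "let B = ?B; C = ?C in mat_det (B * C) = mat_det C * mat_det B"
    by (simp only: Let_def)
next
  fix p q :: nat and u v w :: "nat \<times> nat \<Rightarrow> 'v"
  let ?U = "general_mat p p u" and ?V = "general_mat q q v" and ?W = "general_mat p q w"
  let ?T = "four_block_mat ?U ?W (0\<^sub>m q p) ?V"
  have U: "?U \<in> carrier_mat p p" and V: "?V \<in> carrier_mat q q" and W: "?W \<in> carrier_mat p q"
    by (rule general_mat_carrier)+
  have T: "?T \<in> carrier_mat (p + q) (p + q)" using four_block_carrier_mat[OF U V] .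
  note eqs = mat_det_eq[OF U] mat_det_eq[OF V] mat_det_eq[OF T]
    mat_comatrix_eq[OF U] mat_comatrix_eq[OF V] mat_comatrix_eq[OF T]
  show "let U = ?U; V = ?V; W = ?W; T = four_block_mat U W (0\<^sub>m q p) V in
        mat_det T = mat_det U * mat_det V \<and>
        mat_comatrix T =
          four_block_mat
            (mat_det V \<cdot>\<^sub>m mat_comatrix U) (- (mat_comatrix U * W * mat_comatrix V))
            (0\<^sub>m q p) (mat_det U \<cdot>\<^sub>m mat_comatrix V)"
    unfolding Let_def eqs block_triangular[OF U W V] block_adj_def
      carrier_matD(1)[OF U] carrier_matD(1)[OF V]
    by simp
qed

end
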